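(* Suppose $(P,Q,R)$ satisfies the non-linear system of differential equations associated to the generalised Chazy equation with parameter $k=9$, i.e. $$\frac{dP}{dx}=\frac16(P^2-Q),\qquad \frac{dQ}{dx}=\frac23(PQ-R),\qquad \frac{dR}{dx}=PR-\frac95Q^2.$$ Then the following holds. The triple $$\left(P-\lambda,\;-\frac{5}{4}Q+\frac{5}{36}\mu^2+5\lambda^2,\;\frac{5}{9}\mu^3-15\lambda^3+\frac{349}{54}Q\lambda+\frac{181}{216}Q\mu-\frac{181}{216}R\right)$$ also satisfies the non-linear system of differential equations associated to the generalised Chazy equation with parameter $k=9$, where $\mu$ is a root of the quartic equation $$\mu^4-\frac{6}{5}Q\mu^2-\frac{8}{15}R\mu-\frac{3}{25}Q^2=0,$$ and $\lambda=\frac{1}{8}\mu-\frac{9}{40}\frac{Q}{\mu}$ satisfies $$\lambda^4-\frac{R}{Q}\lambda^3+\frac{3}{5}Q\lambda^2-\frac{R}{15}\lambda+\frac{1}{960}\frac{R^2}{Q}-\frac{3}{1600}Q^2=0.$$ For the same $\mu$ and $\lambda$ the triple $$\left(P+\mu,\;-\frac{4}{5}Q+4\mu^2,\;\frac{4}{15}R+8\mu^3-\frac{28}{15}Q\mu-\frac{16}{15}Q\lambda\right)$$ satisfies the non-linear system of differential equations associated to the generalised Chazy equation with parameter $k=18$. Conversely, let $(P,Q,R)$ be a solution to the system associated to the $k=18$ generalised Chazy equation, i.e. $$\frac{dP}{dx}=\frac16(P^2-Q),\qquad \frac{dQ}{dx}=\frac23(PQ-R),\qquad \frac{dR}{dx}=PR-\frac98Q^2.$$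 Let $$\chi=-\frac{R}{2Q}\mp\sqrt{\frac{R^2}{4Q^2}-\frac{9}{32}Q}.$$ Then $$\left(P+\chi,\;-\frac{5}{32}Q+5\chi^2,\;-\frac{5}{4}R-\frac{55}{8}Q\chi+15\chi^3\right)$$ solves the first order system associated to the $k=9$ generalised Chazy equation.
   Context: The generalised Chazy equation with parameter $k$, for a function $y$ of $x$ (with $'=d/dx$), is $$y'''-2yy''+3y'^2-\frac{4}{36-k^2}(6y'-y^2)^2=0.$$ Taking $P=y$, it is equivalent to the non-linear first order system, for functions $P,Q,R$ of $x$, $$P'=\frac16(P^2-Q),\qquad Q'=\frac23(PQ-R),\qquad R'=PR+\frac{k^2}{36-k^2}Q^2,$$ called the system associated to the generalised Chazy equation with parameter $k$. A triple satisfies (or solves) this system if its first, second and third entries satisfy these equations in the roles of $P,Q,R$ respectively; in that case $y=P$ (the first entry) is a solution to the generalised Chazy equation with parameter $k$.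
   Formalization: Two coefficients are corrected, as each first entry forces the second: 5/36 μ² becomes 5/4 μ² in the first triple, and −5/32 Q becomes −5/4 Q in the last; as printed they would need μ=0 or Q=0. μ and the square root are continuous branches, with μ≠0, and Q≠0 where it is divided by. *)

theory Defs
  imports "HOL-Analysis.Analysis"
begin

(* The functions are functions of one complex variable on a set S, which is meant to be open
   (so that the solutions are holomorphic there).  The parameter must satisfy k^2 \<noteq> 36, as
   division by 0 yields 0.

   The first equation determines the second entry of a solution from the first one
   (Q = P^2 - 6 P'), and the second equation then determines the third one
   (R = P Q - 3/2 Q').  For the transformed triples in the theorem this forces the second entries
     -5/4 Q + 5/4 mu^2 + 5 lambda^2   (k = 9, from k = 9)    and
     -5/4 Q + 5 chi^2                 (k = 9, from k = 18),
   which are also the ones compatible with the published third entries; the published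
   coefficients 5/36 (of mu^2) and -5/32 (of Q) are misprints. *)
definition gen_chazy_system ::
  "complex \<Rightarrow> complex set \<Rightarrow> (complex \<Rightarrow> complex) \<Rightarrow> (complex \<Rightarrow> complex) \<Rightarrow> (complex \<Rightarrow> complex) \<Rightarrow> bool"
  where "gen_chazy_system k S P Q R \<longleftrightarrow>
    (\<forall>x\<in>S.
      (P has_field_derivative 1/6 * ((P x)^2 - Q x)) (at x) \<and>
      (Q has_field_derivative 2/3 * (P x * Q x - R x)) (at x) \<and>
      (R has_field_derivative P x * R x + k^2 / (36 - k^2) * (Q x)^2) (at x))"

lemma gen_chazy_system_9:
  "gen_chazy_system 9 S P Q R \<longleftrightarrow>
    (\<forall>x\<in>S.
      (P has_field_derivative 1/6 * ((P x)^2 - Q x)) (at x) \<and>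
      (Q has_field_derivative 2/3 * (P x * Q x - R x)) (at x) \<and>
      (R has_field_derivative P x * R x - 9/5 * (Q x)^2) (at x))"
  by (simp add: gen_chazy_system_def)

lemma gen_chazy_system_18:
  "gen_chazy_system 18 S P Q R \<longleftrightarrow>
    (\<forall>x\<in>S.
      (P has_field_derivative 1/6 * ((P x)^2 - Q x)) (at x) \<and>
      (Q has_field_derivative 2/3 * (P x * Q x - R x)) (at x) \<and>
      (R has_field_derivative P x * R x - 9/8 * (Q x)^2) (at x))"
  by (simp add: gen_chazy_system_def)

end

theory Submission
  imports Defs "HOL-Complex_Analysis.Cauchy_Integral_Theorem"
begin

text \<open>
  Each transformation adds to \<open>P\<close> a function that is algebraic over \<open>Q\<close> and \<open>R\<close>: \<open>mu\<close>, \<open>chi\<close>, or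
  \<open>- lam\<close>, which is a rational function of \<open>mu\<close> and \<open>Q\<close>.  The heart of the matter is that the roots
  \<open>mu\<close> and \<open>chi\<close> solve Riccati equations:
  \<open>mu' = P mu / 3 - mu\<^sup>2 / 2 + 3 Q / 10\<close> for the quartic in the case \<open>k = 9\<close>
  (\<open>quartic_root_has_field_derivative\<close>), and \<open>chi' = P chi / 3 - 2 chi\<^sup>2 / 3 + 3 Q / 8\<close> for the
  quadratic in the case \<open>k = 18\<close> (\<open>quadratic_root_has_field_derivative\<close>).
  Given these, every equation of the transformed systems is a polynomial identity modulo the
  equation of the root.  That equation is linear in \<open>R\<close>, so dividing it by the root expresses \<open>R\<close>
  as a polynomial in the root and in \<open>q = Q / mu\<close> (or \<open>Q / chi\<close>); after this substitution the
  identities hold by expansion.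

  The root is only assumed to be continuous.  Where it is a simple root, differentiating its
  equation gives the Riccati equation (\<open>implicit_has_field_derivative\<close>).  At a multiple root this
  fails, and what helps is that the system controls multiple roots.  They can occur only where
  \<open>D = 9 Q\<^sup>3 - 5 R\<^sup>2\<close> (for \<open>k = 9\<close>) or \<open>D = 9 Q\<^sup>3 - 8 R\<^sup>2\<close> (for \<open>k = 18\<close>) vanishes, and along
  solutions \<open>D' = 2 P D\<close>.  A zero of a solution of such a linear equation spreads to a
  neighbourhood (\<open>gen_chazy_discriminant_zero_spreads\<close>).  So near a multiple root the relation
  \<open>D = 0\<close> holds identically, the multiple root is an explicit quotient of \<open>R\<close> by \<open>Q\<close>, and the
  derivative of that quotient can be computed.
\<close>

section \<open>Implicit differentiation and linear equations\<close>

text \<open>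
  Implicit differentiation of a continuous root.  If \<open>F y (f y) = 0\<close>, then
  \<open>F y (f y) - F y (f x) = - F y (f x)\<close>; for \<open>F\<close> polynomial in its last argument, the left side is
  \<open>(f y - f x) * K y\<close> with \<open>K\<close> continuous and \<open>k = lim K\<close> the partial derivative, which is nonzero
  at a simple root, and the right side is an increment of an explicit function \<open>h\<close>.
\<close>

lemma implicit_has_field_derivative:
  fixes f h K :: "'a::real_normed_field \<Rightarrow> 'a"
  assumes ev: "\<forall>\<^sub>F y in at x. (f y - f x) * K y = h y - h x"
    and K: "(K \<longlongrightarrow> k) (at x)" and k: "k \<noteq> 0"
    and h: "(h has_field_derivative h') (at x)"
  shows "(f has_field_derivative h' / k) (at x)"
proof -
  have lim: "((\<lambda>y. (h y - h x) / (y - x) / K y) \<longlongrightarrow> h' / k) (at x)"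
    using h K k unfolding has_field_derivative_iff by (intro tendsto_divide)
  have "\<forall>\<^sub>F y in at x. K y \<noteq> 0"
    using K k by (rule tendsto_imp_eventually_ne)
  with ev have "\<forall>\<^sub>F y in at x. (h y - h x) / (y - x) / K y = (f y - f x) / (y - x)"
  proof eventually_elim
    case (elim y)
    have "f y - f x = (h y - h x) / K y"
      using elim by (simp add: eq_divide_eq)
    then show ?case by (simp add: field_simps)
  qed
  with lim show ?thesis
    unfolding has_field_derivative_iff by (rule Lim_transform_eventually)
qed

text \<open>
  On a disc the coefficient \<open>p\<close> has a primitive \<open>g\<close>, and \<open>D * exp (- g)\<close> has derivative zero.
\<close>

lemma linear_ode_zero_spreads:
  fixes D p :: "complex \<Rightarrow> complex"
  assumes "open S" "x \<in> S" and p: "p holomorphic_on S"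
    and D: "\<And>y. y \<in> S \<Longrightarrow> (D has_field_derivative p y * D y) (at y)"
    and zero: "D x = 0"
  shows "\<forall>\<^sub>F y in nhds x. D y = 0"
proof -
  obtain r where r: "r > 0" "ball x r \<subseteq> S"
    using assms(1,2) openE by blast
  have "p holomorphic_on ball x r"
    using p r(2) holomorphic_on_subset by blast
  then obtain g where g: "\<And>y. y \<in> ball x r \<Longrightarrow> (g has_field_derivative p y) (at y within ball x r)"
    using holomorphic_convex_primitive'[of "ball x r" p] by auto
  have "((\<lambda>y. D y * exp (- g y)) has_field_derivative 0) (at y within ball x r)"
    if "y \<in> ball x r" for y
  proof -
    have D': "(D has_field_derivative p y * D y) (at y within ball x r)"
      using D r(2) that has_field_derivative_at_within by blast
    show ?thesis
      by (rule derivative_eq_intros D' g[OF that] refl)+ (simp add: algebra_simps)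
  qed
  then obtain c where c: "\<And>y. y \<in> ball x r \<Longrightarrow> D y * exp (- g y) = c"
    using has_field_derivative_zero_constant[of "ball x r" "\<lambda>y. D y * exp (- g y)"] by auto
  have "c = 0"
    using c[of x] zero r(1) by simp
  with c have "D y = 0" if "y \<in> ball x r" for y
    using that by fastforce
  then show ?thesis
    using r(1) eventually_nhds_in_open[of "ball x r" x] by (auto elim: eventually_mono)
qed

section \<open>Algebraic functions of a solution\<close>

lemma gen_chazy_systemD:
  assumes "gen_chazy_system k S P Q R" "x \<in> S"
  shows "(P has_field_derivative 1/6 * ((P x)^2 - Q x)) (at x)"
    and "(Q has_field_derivative 2/3 * (P x * Q x - R x)) (at x)"
    and "(R has_field_derivative P x * R x + k^2 / (36 - k^2) * (Q x)^2) (at x)"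
  using assms by (auto simp: gen_chazy_system_def)

text \<open>
  The ratio \<open>a : b\<close> is the one for which the \<open>Q\<^sup>2 R\<close> terms in the derivative of
  \<open>a Q\<^sup>3 - b R\<^sup>2\<close> cancel; what remains is \<open>2 P (a Q\<^sup>3 - b R\<^sup>2)\<close>.  It is \<open>9 : 5\<close> for \<open>k = 9\<close> and
  \<open>9 : 8\<close> for \<open>k = 18\<close>.
\<close>

lemma gen_chazy_discriminant_zero_spreads:
  assumes "open S" "x \<in> S" and sys: "gen_chazy_system k S P Q R"
    and a: "a = b * (k^2 / (k^2 - 36))"
    and zero: "a * Q x ^ 3 - b * R x ^ 2 = 0"
  shows "\<forall>\<^sub>F y in nhds x. a * Q y ^ 3 - b * R y ^ 2 = 0"
proof (rule linear_ode_zero_spreads[OF assms(1,2)])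
  have "P holomorphic_on S"
    using gen_chazy_systemD(1)[OF sys] holomorphic_on_open[OF \<open>open S\<close>] by blast
  then show "(\<lambda>y. 2 * P y) holomorphic_on S"
    by (intro holomorphic_intros)
next
  fix y assume y: "y \<in> S"
  have a': "a = - b * (k^2 / (36 - k^2))"
    unfolding a by (metis minus_diff_eq minus_divide_right mult_minus_left mult_minus_right)
  show "((\<lambda>y. a * Q y ^ 3 - b * R y ^ 2) has_field_derivative
      2 * P y * (a * Q y ^ 3 - b * R y ^ 2)) (at y)"
    by (rule derivative_eq_intros gen_chazy_systemD[OF sys y] refl)+
      (simp add: a' algebra_simps power2_eq_square power3_eq_cube)
qed (rule zero)

text \<open>
  The quartic is linear in \<open>R\<close>, so its zero set has the rational parametrisation by \<open>mu\<close> and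
  \<open>q = Q / mu\<close>, in which \<open>Q\<close> and \<open>R\<close> are polynomials.
\<close>

lemma quartic_root_normal_form:
  fixes Q R mu :: complex
  assumes "mu \<noteq> 0"
    and "mu ^ 4 - 6/5 * Q * mu ^ 2 - 8/15 * R * mu - 3/25 * Q ^ 2 = 0"
  obtains q where "Q = q * mu" "Q / mu = q"
    and "R = 15/8 * mu ^ 3 - 9/4 * q * mu ^ 2 - 9/40 * q ^ 2 * mu"
proof
  show Q: "Q = Q / mu * mu" using assms(1) by simp
  have "mu * (R - (15/8 * mu ^ 3 - 9/4 * (Q / mu) * mu ^ 2 - 9/40 * (Q / mu) ^ 2 * mu)) = 0"
    using assms(2) Q by algebra
  then show "R = 15/8 * mu ^ 3 - 9/4 * (Q / mu) * mu ^ 2 - 9/40 * (Q / mu) ^ 2 * mu"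
    using assms(1) by simp
qed simp

text \<open>
  In terms of \<open>q = Q / mu\<close>, the derivative of the quartic with respect to \<open>mu\<close> is
  \<open>3 mu (mu - q / 5)\<^sup>2\<close>.  Hence a root with \<open>mu \<noteq> q / 5\<close> is simple.  If \<open>mu = q / 5\<close> then
  \<open>Q = 5 mu\<^sup>2\<close> and \<open>R = - 15 mu\<^sup>3\<close> at that point, so \<open>9 Q\<^sup>3 = 5 R\<^sup>2\<close> there and therefore
  nearby.  With \<open>m = - R / (3 Q)\<close> this turns the quartic into \<open>(mu - m)\<^sup>3 (mu + 3 m) = 0\<close>, and
  continuity leaves only the branch \<open>mu = m\<close>.
\<close>

lemma quartic_root_has_field_derivative:
  fixes P Q R mu :: "complex \<Rightarrow> complex"
  assumes "open S" "x \<in> S" and sys: "gen_chazy_system 9 S P Q R"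
    and cont: "continuous_on S mu" and mu0: "mu x \<noteq> 0"
    and root: "\<And>y. y \<in> S \<Longrightarrow>
      mu y ^ 4 - 6/5 * Q y * mu y ^ 2 - 8/15 * R y * mu y - 3/25 * Q y ^ 2 = 0"
  shows "(mu has_field_derivative P x * mu x / 3 - mu x ^ 2 / 2 + 3/10 * Q x) (at x)"
proof -
  note d = gen_chazy_systemD[OF sys \<open>x \<in> S\<close>]
  have tmu: "(mu \<longlongrightarrow> mu x) (at x)"
    using cont assms(1,2) by (metis continuous_on_eq_continuous_at isContD)
  have tQ: "(Q \<longlongrightarrow> Q x) (at x)" and tR: "(R \<longlongrightarrow> R x) (at x)"
    using d by (auto dest!: DERIV_isCont isContD)
  have near: "\<forall>\<^sub>F y in at x. y \<in> S"
    using assms(1,2) by (rule eventually_at_in_open')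
  obtain q where Qx: "Q x = q * mu x"
    and Rx: "R x = 15/8 * mu x ^ 3 - 9/4 * q * mu x ^ 2 - 9/40 * q ^ 2 * mu x"
    using quartic_root_normal_form[OF mu0 root[OF \<open>x \<in> S\<close>]] by metis
  show ?thesis
  proof (cases "mu x = q / 5")
    case False
    \<comment> \<open>With the coefficients taken at \<open>y\<close>, \<open>K y\<close> is the slope of the quartic between \<open>mu x\<close> and
      \<open>mu y\<close>, and \<open>mu x ^ 4 - h y\<close> is its value at \<open>mu x\<close>; hence \<open>h x = mu x ^ 4\<close>.\<close>
    define K where "K y = (mu y + mu x) * (mu y ^ 2 + mu x ^ 2) - 6/5 * Q y * (mu y + mu x)
      - 8/15 * R y" for y
    define h where "h y = 6/5 * Q y * mu x ^ 2 + 8/15 * R y * mu x + 3/25 * Q y ^ 2" for y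
    have tK: "(K \<longlongrightarrow> (mu x + mu x) * (mu x ^ 2 + mu x ^ 2) - 6/5 * Q x * (mu x + mu x)
      - 8/15 * R x) (at x)"
      unfolding K_def by (intro tendsto_intros tmu tQ tR)
    have Kx: "(mu x + mu x) * (mu x ^ 2 + mu x ^ 2) - 6/5 * Q x * (mu x + mu x) - 8/15 * R x
      = 3 * mu x * (mu x - q / 5) ^ 2"
      unfolding Qx Rx by (simp add: field_simps power2_eq_square power3_eq_cube)
    have ev: "\<forall>\<^sub>F y in at x. (mu y - mu x) * K y = h y - h x"
      using near
    proof eventually_elim
      case (elim y)
      show ?case
        using root[OF elim] root[OF \<open>x \<in> S\<close>] unfolding K_def h_def by algebra
    qed
    have dh: "(h has_field_derivative
        6/5 * (2/3 * (P x * Q x - R x)) * mu x ^ 2 + 8/15 * (P x * R x - 9/5 * Q x ^ 2) * mu x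
        + 6/25 * Q x * (2/3 * (P x * Q x - R x))) (at x)"
      unfolding h_def by (rule derivative_eq_intros d refl)+ (simp add: algebra_simps)
    have k: "3 * mu x * (mu x - q / 5) ^ 2 \<noteq> 0"
      using False mu0 by simp
    have "(P x * mu x / 3 - mu x ^ 2 / 2 + 3/10 * Q x) * (3 * mu x * (mu x - q / 5) ^ 2) =
        6/5 * (2/3 * (P x * Q x - R x)) * mu x ^ 2 + 8/15 * (P x * R x - 9/5 * Q x ^ 2) * mu x
        + 6/25 * Q x * (2/3 * (P x * Q x - R x))"
      unfolding Qx Rx by (simp add: field_simps power2_eq_square power3_eq_cube)
    with implicit_has_field_derivative[OF ev tK[unfolded Kx] k dh] k show ?thesis
      by (metis nonzero_mult_div_cancel_right)
  next
    case True
    then have q: "q = 5 * mu x" by algebra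
    have Qx: "Q x = 5 * mu x ^ 2" and Rx: "R x = - 15 * mu x ^ 3"
      unfolding Qx Rx q by (simp_all add: power2_eq_square power3_eq_cube)
    have D: "\<forall>\<^sub>F y in nhds x. 9 * Q y ^ 3 - 5 * R y ^ 2 = 0"
      by (rule gen_chazy_discriminant_zero_spreads[OF assms(1,2) sys])
        (simp_all add: Qx Rx power2_eq_square power3_eq_cube)
    have Q0: "Q x \<noteq> 0" using mu0 by (simp add: Qx)
    \<comment> \<open>At \<open>x\<close>, \<open>R / Q = - 15 mu\<^sup>3 / (5 mu\<^sup>2) = - 3 mu\<close>.\<close>
    define m where "m y = - R y / (3 * Q y)" for y
    have dm: "(m has_field_derivative P x * mu x / 3 - mu x ^ 2 / 2 + 3/10 * Q x) (at x)"
      unfolding m_def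
      apply (rule derivative_eq_intros d refl)+
      using Q0 apply simp
      using mu0 by (simp add: Qx Rx field_simps power2_eq_square power3_eq_cube)
    have mx: "m x = mu x"
      using mu0 by (simp add: m_def Qx Rx power2_eq_square power3_eq_cube)
    have tm: "(m \<longlongrightarrow> m x) (at x)"
      using dm by (auto dest!: DERIV_isCont isContD)
    have "((\<lambda>y. mu y + 3 * m y) \<longlongrightarrow> mu x + 3 * m x) (at x)"
      by (intro tendsto_intros tm tmu)
    then have ne: "\<forall>\<^sub>F y in at x. mu y + 3 * m y \<noteq> 0"
      by (rule tendsto_imp_eventually_ne) (use mu0 in \<open>simp add: mx\<close>)
    have Qne: "\<forall>\<^sub>F y in at x. Q y \<noteq> 0"
      using tQ Q0 by (rule tendsto_imp_eventually_ne)
    have "\<forall>\<^sub>F y in at x. mu y = m y"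
      using near ne Qne eventually_nhds_conv_at[THEN iffD1, OF D, THEN conjunct1]
    proof eventually_elim
      case (elim y)
      have m: "3 * Q y * m y = - R y" using elim by (simp add: m_def)
      have "Q y ^ 2 * (Q y - 5 * m y ^ 2) = 0"
        using elim(4) m by algebra
      then have Qy: "Q y = 5 * m y ^ 2" using elim by simp
      then have Ry: "R y = - 15 * m y ^ 3" using m by algebra
      have "(mu y - m y) ^ 3 * (mu y + 3 * m y) = 0"
        using root[OF elim(1)] unfolding Qy Ry by algebra
      then show ?case using elim by simp
    qed
    then have "\<forall>\<^sub>F y in nhds x. m y = mu y"
      using mx by (auto simp: eventually_nhds_conv_at elim: eventually_mono)
    then show ?thesis
      using dm DERIV_cong_ev[OF refl _ refl] by blast
  qed
qed

text \<open>
  The same argument for the quadratic equation satisfied by both choices of sign of \<open>chi\<close>: a double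
  root makes the discriminant \<open>R\<^sup>2 - 9 Q\<^sup>3 / 8\<close> vanish at the point, hence nearby, where then
  \<open>chi = - R / (2 Q)\<close>.
\<close>

lemma quadratic_root_has_field_derivative:
  fixes P Q R chi :: "complex \<Rightarrow> complex"
  assumes "open S" "x \<in> S" and sys: "gen_chazy_system 18 S P Q R"
    and cont: "continuous_on S chi" and Q0: "Q x \<noteq> 0"
    and root: "\<And>y. y \<in> S \<Longrightarrow> Q y * chi y ^ 2 + R y * chi y + 9/32 * Q y ^ 2 = 0"
  shows "(chi has_field_derivative P x * chi x / 3 - 2/3 * chi x ^ 2 + 3/8 * Q x) (at x)"
proof -
  note d = gen_chazy_systemD[OF sys \<open>x \<in> S\<close>]
  have tchi: "(chi \<longlongrightarrow> chi x) (at x)"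
    using cont assms(1,2) by (metis continuous_on_eq_continuous_at isContD)
  have tQ: "(Q \<longlongrightarrow> Q x) (at x)" and tR: "(R \<longlongrightarrow> R x) (at x)"
    using d by (auto dest!: DERIV_isCont isContD)
  have near: "\<forall>\<^sub>F y in at x. y \<in> S"
    using assms(1,2) by (rule eventually_at_in_open')
  show ?thesis
  proof (cases "2 * Q x * chi x + R x = 0")
    case False
    \<comment> \<open>With the coefficients taken at \<open>y\<close>, \<open>K y\<close> is the slope of the quadratic between \<open>chi x\<close> and
      \<open>chi y\<close>, and \<open>- h y\<close> is its value at \<open>chi x\<close>; hence \<open>h x = 0\<close>.\<close>
    define K where "K y = Q y * (chi y + chi x) + R y" for y
    define h where "h y = - (Q y * chi x ^ 2) - R y * chi x - 9/32 * Q y ^ 2" for y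
    have tK: "(K \<longlongrightarrow> Q x * (chi x + chi x) + R x) (at x)"
      unfolding K_def by (intro tendsto_intros tchi tQ tR)
    have k: "Q x * (chi x + chi x) + R x \<noteq> 0"
      using False by (simp add: algebra_simps)
    have ev: "\<forall>\<^sub>F y in at x. (chi y - chi x) * K y = h y - h x"
      using near
    proof eventually_elim
      case (elim y)
      show ?case
        using root[OF elim] root[OF \<open>x \<in> S\<close>] unfolding K_def h_def by algebra
    qed
    have dh: "(h has_field_derivative
        - (2/3 * (P x * Q x - R x) * chi x ^ 2) - (P x * R x - 9/8 * Q x ^ 2) * chi x
        - 9/16 * Q x * (2/3 * (P x * Q x - R x))) (at x)"
      unfolding h_def by (rule derivative_eq_intros d refl)+ (simp add: algebra_simps)
    have "(P x * chi x / 3 - 2/3 * chi x ^ 2 + 3/8 * Q x) * (Q x * (chi x + chi x) + R x) =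
        - (2/3 * (P x * Q x - R x) * chi x ^ 2) - (P x * R x - 9/8 * Q x ^ 2) * chi x
        - 9/16 * Q x * (2/3 * (P x * Q x - R x))"
      using root[OF \<open>x \<in> S\<close>] by algebra
    with implicit_has_field_derivative[OF ev tK k dh] k show ?thesis
      by (metis nonzero_mult_div_cancel_right)
  next
    case True
    have Rx: "R x = - 2 * Q x * chi x" using True by algebra
    have "Q x * (9/32 * Q x - chi x ^ 2) = 0"
      using root[OF \<open>x \<in> S\<close>] unfolding Rx by algebra
    then have "9/32 * Q x = chi x ^ 2" using Q0 by simp
    then have Qx: "Q x = 32/9 * chi x ^ 2" by algebra
    have D: "\<forall>\<^sub>F y in nhds x. 9 * Q y ^ 3 - 8 * R y ^ 2 = 0"
      by (rule gen_chazy_discriminant_zero_spreads[OF assms(1,2) sys])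
        (simp_all add: Qx Rx power2_eq_square power3_eq_cube)
    have chi0: "chi x \<noteq> 0" using Q0 by (simp add: Qx)
    define m where "m y = - R y / (2 * Q y)" for y
    have dm: "(m has_field_derivative P x * chi x / 3 - 2/3 * chi x ^ 2 + 3/8 * Q x) (at x)"
      unfolding m_def
      apply (rule derivative_eq_intros d refl)+
      using Q0 apply simp
      using chi0 by (simp add: Qx Rx field_simps power2_eq_square power3_eq_cube)
    have mx: "m x = chi x"
      using Q0 by (simp add: m_def Rx)
    have Qne: "\<forall>\<^sub>F y in at x. Q y \<noteq> 0"
      using tQ Q0 by (rule tendsto_imp_eventually_ne)
    have "\<forall>\<^sub>F y in at x. chi y = m y"
      using near Qne eventually_nhds_conv_at[THEN iffD1, OF D, THEN conjunct1]
    proof eventually_elim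
      case (elim y)
      have m: "2 * Q y * m y = - R y" using elim by (simp add: m_def)
      have "(Q y * (chi y - m y)) ^ 2 = 0"
        using root[OF elim(1)] elim(3) m by algebra
      then show ?case using elim by simp
    qed
    then have "\<forall>\<^sub>F y in nhds x. m y = chi y"
      using mx by (auto simp: eventually_nhds_conv_at elim: eventually_mono)
    then show ?thesis
      using dm DERIV_cong_ev[OF refl _ refl] by blast
  qed
qed

section \<open>The transformed systems\<close>

lemma lambda_quartic:
  fixes Q R mu lam :: complex
  assumes "mu \<noteq> 0" "Q \<noteq> 0"
    and "mu ^ 4 - 6/5 * Q * mu ^ 2 - 8/15 * R * mu - 3/25 * Q ^ 2 = 0"
    and "lam = 1/8 * mu - 9/40 * (Q / mu)"
  shows "lam ^ 4 - R / Q * lam ^ 3 + 3/5 * Q * lam ^ 2 - R / 15 * lam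
    + 1/960 * (R ^ 2 / Q) - 3/1600 * Q ^ 2 = 0"
proof -
  obtain q where q: "Q = q * mu" "R = 15/8 * mu ^ 3 - 9/4 * q * mu ^ 2 - 9/40 * q ^ 2 * mu"
      "lam = 1/8 * mu - 9/40 * q"
    using quartic_root_normal_form[OF assms(1,3)] assms(4) by metis
  have "Q * lam ^ 4 - R * lam ^ 3 + 3/5 * Q ^ 2 * lam ^ 2 - Q * R / 15 * lam
    + 1/960 * R ^ 2 - 3/1600 * Q ^ 3 = 0"
    unfolding q by (simp add: field_simps power2_eq_square power3_eq_cube power4_eq_xxxx)
  then have "Q * (lam ^ 4 - R / Q * lam ^ 3 + 3/5 * Q * lam ^ 2 - R / 15 * lam
    + 1/960 * (R ^ 2 / Q) - 3/1600 * Q ^ 2) = 0"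
    using assms(2) by (simp add: field_simps power2_eq_square power3_eq_cube)
  then show ?thesis using assms(2) by simp
qed

text \<open>
  Both transformations rest on the derivatives of \<open>mu\<close> and of \<open>lam\<close>.  The latter follows from the
  former; writing it through \<open>q = Q / mu\<close> keeps all identities polynomial.
\<close>

lemma transformed_systems_from_9:
  fixes P Q R mu lam :: "complex \<Rightarrow> complex"
  assumes "open S" and sys: "gen_chazy_system 9 S P Q R"
    and cont: "continuous_on S mu" and mu0: "\<And>x. x \<in> S \<Longrightarrow> mu x \<noteq> 0"
    and root: "\<And>x. x \<in> S \<Longrightarrow>
      mu x ^ 4 - 6/5 * Q x * mu x ^ 2 - 8/15 * R x * mu x - 3/25 * Q x ^ 2 = 0"
    and lam: "\<And>x. x \<in> S \<Longrightarrow> lam x = 1/8 * mu x - 9/40 * (Q x / mu x)"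
  shows "gen_chazy_system 9 S
          (\<lambda>x. P x - lam x)
          (\<lambda>x. - 5/4 * Q x + 5/4 * mu x ^ 2 + 5 * lam x ^ 2)
          (\<lambda>x. 5/9 * mu x ^ 3 - 15 * lam x ^ 3 + 349/54 * Q x * lam x
                + 181/216 * Q x * mu x - 181/216 * R x)" (is ?A)
    and "gen_chazy_system 18 S
          (\<lambda>x. P x + mu x)
          (\<lambda>x. - 4/5 * Q x + 4 * mu x ^ 2)
          (\<lambda>x. 4/15 * R x + 8 * mu x ^ 3 - 28/15 * Q x * mu x - 16/15 * Q x * lam x)" (is ?B)
proof -
  have *: "\<exists>q. Q x = q * mu x \<and> R x = 15/8 * mu x ^ 3 - 9/4 * q * mu x ^ 2 - 9/40 * q ^ 2 * mu x \<and>
      lam x = 1/8 * mu x - 9/40 * q \<and>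
      (mu has_field_derivative P x * mu x / 3 - mu x ^ 2 / 2 + 3/10 * Q x) (at x) \<and>
      (lam has_field_derivative
        P x * lam x / 3 + 7/32 * mu x ^ 2 - 33/80 * q * mu x + 27/800 * q ^ 2) (at x)"
    if x: "x \<in> S" for x
  proof -
    note d = gen_chazy_systemD[OF sys x]
    have dmu: "(mu has_field_derivative P x * mu x / 3 - mu x ^ 2 / 2 + 3/10 * Q x) (at x)"
      by (rule quartic_root_has_field_derivative[OF assms(1) x sys cont mu0[OF x] root])
    obtain q where q: "Q x = q * mu x" "R x = 15/8 * mu x ^ 3 - 9/4 * q * mu x ^ 2 - 9/40 * q ^ 2 * mu x"
      "lam x = 1/8 * mu x - 9/40 * q"
      using quartic_root_normal_form[OF mu0[OF x] root[OF x]] lam[OF x] by metis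
    have "((\<lambda>x. 1/8 * mu x - 9/40 * (Q x / mu x)) has_field_derivative
        P x * lam x / 3 + 7/32 * mu x ^ 2 - 33/80 * q * mu x + 27/800 * q ^ 2) (at x)"
      apply (rule derivative_eq_intros d dmu refl mu0 x)+
      using mu0[OF x] by (simp add: q field_simps power2_eq_square power3_eq_cube)
    then have "(lam has_field_derivative
        P x * lam x / 3 + 7/32 * mu x ^ 2 - 33/80 * q * mu x + 27/800 * q ^ 2) (at x)"
      by (rule has_field_derivative_transform_within_open[OF _ assms(1) x]) (simp add: lam)
    then show ?thesis using q dmu by blast
  qed
  show ?A
    unfolding gen_chazy_system_9
  proof (intro ballI)
    fix x assume x: "x \<in> S"
    note d = gen_chazy_systemD[OF sys x]
    obtain q where q: "Q x = q * mu x" "R x = 15/8 * mu x ^ 3 - 9/4 * q * mu x ^ 2 - 9/40 * q ^ 2 * mu x"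
      "lam x = 1/8 * mu x - 9/40 * q"
      and d': "(mu has_field_derivative P x * mu x / 3 - mu x ^ 2 / 2 + 3/10 * Q x) (at x)"
        "(lam has_field_derivative
          P x * lam x / 3 + 7/32 * mu x ^ 2 - 33/80 * q * mu x + 27/800 * q ^ 2) (at x)"
      using *[OF x] by blast
    show "((\<lambda>x. P x - lam x) has_field_derivative
        1/6 * ((P x - lam x)^2 - (- 5/4 * Q x + 5/4 * mu x ^ 2 + 5 * lam x ^ 2))) (at x) \<and>
      ((\<lambda>x. - 5/4 * Q x + 5/4 * mu x ^ 2 + 5 * lam x ^ 2) has_field_derivative
        2/3 * ((P x - lam x) * (- 5/4 * Q x + 5/4 * mu x ^ 2 + 5 * lam x ^ 2)
          - (5/9 * mu x ^ 3 - 15 * lam x ^ 3 + 349/54 * Q x * lam x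
                + 181/216 * Q x * mu x - 181/216 * R x))) (at x) \<and>
      ((\<lambda>x. 5/9 * mu x ^ 3 - 15 * lam x ^ 3 + 349/54 * Q x * lam x
                + 181/216 * Q x * mu x - 181/216 * R x) has_field_derivative
        (P x - lam x) * (5/9 * mu x ^ 3 - 15 * lam x ^ 3 + 349/54 * Q x * lam x
                + 181/216 * Q x * mu x - 181/216 * R x)
          - 9/5 * (- 5/4 * Q x + 5/4 * mu x ^ 2 + 5 * lam x ^ 2)^2) (at x)"
      by (intro conjI; (rule derivative_eq_intros d d' refl)+)
        (simp_all add: q field_simps power2_eq_square power3_eq_cube)
  qed
  show ?B
    unfolding gen_chazy_system_18
  proof (intro ballI)
    fix x assume x: "x \<in> S"
    note d = gen_chazy_systemD[OF sys x]
    obtain q where q: "Q x = q * mu x" "R x = 15/8 * mu x ^ 3 - 9/4 * q * mu x ^ 2 - 9/40 * q ^ 2 * mu x"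
      "lam x = 1/8 * mu x - 9/40 * q"
      and d': "(mu has_field_derivative P x * mu x / 3 - mu x ^ 2 / 2 + 3/10 * Q x) (at x)"
        "(lam has_field_derivative
          P x * lam x / 3 + 7/32 * mu x ^ 2 - 33/80 * q * mu x + 27/800 * q ^ 2) (at x)"
      using *[OF x] by blast
    show "((\<lambda>x. P x + mu x) has_field_derivative
        1/6 * ((P x + mu x)^2 - (- 4/5 * Q x + 4 * mu x ^ 2))) (at x) \<and>
      ((\<lambda>x. - 4/5 * Q x + 4 * mu x ^ 2) has_field_derivative
        2/3 * ((P x + mu x) * (- 4/5 * Q x + 4 * mu x ^ 2)
          - (4/15 * R x + 8 * mu x ^ 3 - 28/15 * Q x * mu x - 16/15 * Q x * lam x))) (at x) \<and>
      ((\<lambda>x. 4/15 * R x + 8 * mu x ^ 3 - 28/15 * Q x * mu x - 16/15 * Q x * lam x)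
        has_field_derivative
        (P x + mu x) * (4/15 * R x + 8 * mu x ^ 3 - 28/15 * Q x * mu x - 16/15 * Q x * lam x)
          - 9/8 * (- 4/5 * Q x + 4 * mu x ^ 2)^2) (at x)"
      by (intro conjI; (rule derivative_eq_intros d d' refl)+)
        (simp_all add: q field_simps power2_eq_square power3_eq_cube)
  qed
qed

lemma transformed_system_from_18:
  fixes P Q R chi :: "complex \<Rightarrow> complex"
  assumes "open S" and sys: "gen_chazy_system 18 S P Q R"
    and cont: "continuous_on S chi" and Q0: "\<And>x. x \<in> S \<Longrightarrow> Q x \<noteq> 0"
    and root: "\<And>x. x \<in> S \<Longrightarrow> Q x * chi x ^ 2 + R x * chi x + 9/32 * Q x ^ 2 = 0"
  shows "gen_chazy_system 9 S
          (\<lambda>x. P x + chi x)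
          (\<lambda>x. - 5/4 * Q x + 5 * chi x ^ 2)
          (\<lambda>x. - 5/4 * R x - 55/8 * Q x * chi x + 15 * chi x ^ 3)"
  unfolding gen_chazy_system_9
proof (intro ballI)
  fix x assume x: "x \<in> S"
  note d = gen_chazy_systemD[OF sys x]
  have d': "(chi has_field_derivative P x * chi x / 3 - 2/3 * chi x ^ 2 + 3/8 * Q x) (at x)"
    by (rule quadratic_root_has_field_derivative[OF assms(1) x sys cont Q0[OF x] root])
  have chi0: "chi x \<noteq> 0"
    using root[OF x] Q0[OF x] by auto
  \<comment> \<open>The quadratic is linear in \<open>R\<close>; in \<open>chi\<close> and \<open>r\<close> both \<open>Q\<close> and \<open>R\<close> are polynomials.\<close>
  define r where "r = Q x / chi x"
  have r: "Q x = r * chi x"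
    using chi0 by (simp add: r_def)
  have "chi x * (R x + r * chi x ^ 2 + 9/32 * r ^ 2 * chi x) = 0"
    using root[OF x] unfolding r by algebra
  then have Rx: "R x = - (r * chi x ^ 2) - 9/32 * r ^ 2 * chi x"
    using chi0 by (simp add: algebra_simps) algebra
  show "((\<lambda>x. P x + chi x) has_field_derivative
      1/6 * ((P x + chi x)^2 - (- 5/4 * Q x + 5 * chi x ^ 2))) (at x) \<and>
    ((\<lambda>x. - 5/4 * Q x + 5 * chi x ^ 2) has_field_derivative
      2/3 * ((P x + chi x) * (- 5/4 * Q x + 5 * chi x ^ 2)
        - (- 5/4 * R x - 55/8 * Q x * chi x + 15 * chi x ^ 3))) (at x) \<and>
    ((\<lambda>x. - 5/4 * R x - 55/8 * Q x * chi x + 15 * chi x ^ 3) has_field_derivative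
      (P x + chi x) * (- 5/4 * R x - 55/8 * Q x * chi x + 15 * chi x ^ 3)
        - 9/5 * (- 5/4 * Q x + 5 * chi x ^ 2)^2) (at x)"
    by (intro conjI; (rule derivative_eq_intros d d' refl)+)
      (simp_all add: r Rx field_simps power2_eq_square power3_eq_cube)
qed

theorem theorem6p1:
  fixes S :: "complex set"
  assumes "open S"
  shows
    "(\<forall>P Q R mu lam :: complex \<Rightarrow> complex.
        gen_chazy_system 9 S P Q R \<longrightarrow>
        continuous_on S mu \<longrightarrow>
        (\<forall>x\<in>S. mu x \<noteq> 0) \<longrightarrow>
        (\<forall>x\<in>S. mu x ^ 4 - 6/5 * Q x * mu x ^ 2 - 8/15 * R x * mu x - 3/25 * Q x ^ 2 = 0) \<longrightarrow>
        (\<forall>x\<in>S. lam x = 1/8 * mu x - 9/40 * (Q x / mu x)) \<longrightarrow>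
        gen_chazy_system 9 S
          (\<lambda>x. P x - lam x)
          (\<lambda>x. - 5/4 * Q x + 5/4 * mu x ^ 2 + 5 * lam x ^ 2)
          (\<lambda>x. 5/9 * mu x ^ 3 - 15 * lam x ^ 3 + 349/54 * Q x * lam x
                + 181/216 * Q x * mu x - 181/216 * R x) \<and>
        (\<forall>x\<in>S. Q x \<noteq> 0 \<longrightarrow>
          lam x ^ 4 - R x / Q x * lam x ^ 3 + 3/5 * Q x * lam x ^ 2 - R x / 15 * lam x
            + 1/960 * (R x ^ 2 / Q x) - 3/1600 * Q x ^ 2 = 0) \<and>
        gen_chazy_system 18 S
          (\<lambda>x. P x + mu x)
          (\<lambda>x. - 4/5 * Q x + 4 * mu x ^ 2)
          (\<lambda>x. 4/15 * R x + 8 * mu x ^ 3 - 28/15 * Q x * mu x - 16/15 * Q x * lam x))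
     \<and>
     (\<forall>P Q R s chi :: complex \<Rightarrow> complex.
        gen_chazy_system 18 S P Q R \<longrightarrow>
        (\<forall>x\<in>S. Q x \<noteq> 0) \<longrightarrow>
        continuous_on S s \<longrightarrow>
        (\<forall>x\<in>S. s x ^ 2 = R x ^ 2 / (4 * Q x ^ 2) - 9/32 * Q x) \<longrightarrow>
        ((\<forall>x\<in>S. chi x = - (R x / (2 * Q x)) - s x) \<or>
        (\<forall>x\<in>S. chi x = - (R x / (2 * Q x)) + s x)) \<longrightarrow>
        gen_chazy_system 9 S
          (\<lambda>x. P x + chi x)
          (\<lambda>x. - 5/4 * Q x + 5 * chi x ^ 2)
          (\<lambda>x. - 5/4 * R x - 55/8 * Q x * chi x + 15 * chi x ^ 3))"
proof (intro conjI allI impI)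
  fix P Q R mu lam :: "complex \<Rightarrow> complex"
  assume sys: "gen_chazy_system 9 S P Q R" and cont: "continuous_on S mu"
    and mu0: "\<forall>x\<in>S. mu x \<noteq> 0"
    and root: "\<forall>x\<in>S. mu x ^ 4 - 6/5 * Q x * mu x ^ 2 - 8/15 * R x * mu x - 3/25 * Q x ^ 2 = 0"
    and lam: "\<forall>x\<in>S. lam x = 1/8 * mu x - 9/40 * (Q x / mu x)"
  show "gen_chazy_system 9 S
          (\<lambda>x. P x - lam x)
          (\<lambda>x. - 5/4 * Q x + 5/4 * mu x ^ 2 + 5 * lam x ^ 2)
          (\<lambda>x. 5/9 * mu x ^ 3 - 15 * lam x ^ 3 + 349/54 * Q x * lam x
                + 181/216 * Q x * mu x - 181/216 * R x)"
    using mu0 root lam by (intro transformed_systems_from_9(1)[OF assms sys cont]) auto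
  show "gen_chazy_system 18 S
          (\<lambda>x. P x + mu x)
          (\<lambda>x. - 4/5 * Q x + 4 * mu x ^ 2)
          (\<lambda>x. 4/15 * R x + 8 * mu x ^ 3 - 28/15 * Q x * mu x - 16/15 * Q x * lam x)"
    using mu0 root lam by (intro transformed_systems_from_9(2)[OF assms sys cont]) auto
  show "\<forall>x\<in>S. Q x \<noteq> 0 \<longrightarrow>
          lam x ^ 4 - R x / Q x * lam x ^ 3 + 3/5 * Q x * lam x ^ 2 - R x / 15 * lam x
            + 1/960 * (R x ^ 2 / Q x) - 3/1600 * Q x ^ 2 = 0"
    using mu0 root lam by (intro ballI impI lambda_quartic) auto
next
  fix P Q R s chi :: "complex \<Rightarrow> complex"
  assume sys: "gen_chazy_system 18 S P Q R" and Q0: "\<forall>x\<in>S. Q x \<noteq> 0"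
    and s: "continuous_on S s" "\<forall>x\<in>S. s x ^ 2 = R x ^ 2 / (4 * Q x ^ 2) - 9/32 * Q x"
    and chi: "(\<forall>x\<in>S. chi x = - (R x / (2 * Q x)) - s x) \<or>
        (\<forall>x\<in>S. chi x = - (R x / (2 * Q x)) + s x)"
  have "continuous_on S Q" "continuous_on S R"
    using gen_chazy_systemD[OF sys]
    by (meson DERIV_isCont continuous_at_imp_continuous_on)+
  then have "continuous_on S (\<lambda>x. - (R x / (2 * Q x)) - s x)"
    "continuous_on S (\<lambda>x. - (R x / (2 * Q x)) + s x)"
    using s(1) Q0 by (auto intro!: continuous_intros)
  then have cont: "continuous_on S chi"
    using chi by (metis (no_types, lifting) continuous_on_cong)
  have root: "Q x * chi x ^ 2 + R x * chi x + 9/32 * Q x ^ 2 = 0" if x: "x \<in> S" for x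
  proof -
    define w where "w = R x / (2 * Q x)"
    have R: "R x = 2 * Q x * w" using Q0 x by (simp add: w_def)
    have "s x ^ 2 = w ^ 2 - 9/32 * Q x"
      using s(2) x by (simp add: w_def power_divide power_mult_distrib)
    moreover have "chi x = - w - s x \<or> chi x = - w + s x"
      using chi x by (auto simp: w_def)
    ultimately show ?thesis
      unfolding R by algebra
  qed
  show "gen_chazy_system 9 S
          (\<lambda>x. P x + chi x)
          (\<lambda>x. - 5/4 * Q x + 5 * chi x ^ 2)
          (\<lambda>x. - 5/4 * R x - 55/8 * Q x * chi x + 15 * chi x ^ 3)"
    using Q0 root by (intro transformed_system_from_18[OF assms sys cont]) auto
qed

end
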